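(* On the set $D = \mathbb{Z}\times\mathbb{Z}$ define addition and multiplication by $$(k_1,k_2) + (t_1,t_2) = (k_1+t_1,\; k_2+t_2),$$ $$(k_1,k_2)(t_1,t_2) = (k_1+t_1,\; k_1t_1 + k_2 + t_2).$$ Then $D$ with these operations is a one-generator left brace. If $A$ is an arbitrary one-generator left brace such that $A\in\mathcal{N}_S(3,3)$, then there exists an epimorphism of left braces $f: D\to A$.
   Context: A left brace is a set $A$ with two binary operations $+$ and $\cdot$ such that $(A,+)$ is an abelian group, $(A,\cdot)$ is a group, and $a(b+c) = ab + ac - a$ for all $a,b,c\in A$. For $a,b\in A$ put $a*b = ab - a - b$. A subbrace of $A$ is a subset that is a subgroup of both the additive and the multiplicative group of $A$. $A$ is a one-generator left brace if there is an element $a\in A$ such that the smallest subbrace of $A$ containing $a$ is $A$ itself. An epimorphism of left braces is a surjective map preserving both addition and multiplication. For $K,L\subseteq A$, $K*L$ denotes the subgroup of $(A,+)$ generated by all elements $x*y$ with $x\in K$, $y\in L$. Put $A^{(1)}=A$, $A^{(n+1)} = A^{(n)}*A$, and $A^1 = A$, $A^{k+1} = A*A^k$ for positive integers $n,k$; in particular $A^2=A^{(2)}=A*A$, $A^{(3)} = (A*A)*A$ and $A^3 = A*(A*A)$. $\mathcal{N}_S(n,k)$ denotes the class of left braces $A$ with $A^{(n)}=\{0\}=A^k$, where $n$ and $k$ are each the least positive integers with this property. *)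

theory Defs
  imports "HOL-Algebra.Algebra"
begin

text \<open>
  Braces reuse the ring record of HOL-Algebra for its two operations; the fields
  \<open>zero\<close> and \<open>one\<close> are the additive and the multiplicative identity (the brace
  axiom forces them to be equal).
\<close>

locale left_brace = abelian_group A + group A for A (structure) +
  assumes brace_distrib:
    "\<lbrakk>a \<in> carrier A; b \<in> carrier A; c \<in> carrier A\<rbrakk>
      \<Longrightarrow> a \<otimes> (b \<oplus> c) = (a \<otimes> b \<oplus> a \<otimes> c) \<ominus> a"

definition brace_star :: "('a, 'm) ring_scheme \<Rightarrow> 'a \<Rightarrow> 'a \<Rightarrow> 'a" where
  "brace_star A a b = (a \<otimes>\<^bsub>A\<^esub> b \<ominus>\<^bsub>A\<^esub> a) \<ominus>\<^bsub>A\<^esub> b"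

definition subbrace :: "'a set \<Rightarrow> ('a, 'm) ring_scheme \<Rightarrow> bool" where
  "subbrace S A \<longleftrightarrow> subgroup S (add_monoid A) \<and> subgroup S A"

definition subbrace_generated :: "('a, 'm) ring_scheme \<Rightarrow> 'a \<Rightarrow> 'a set" where
  "subbrace_generated A a = \<Inter>{S. subbrace S A \<and> a \<in> S}"

definition one_generator_left_brace :: "('a, 'm) ring_scheme \<Rightarrow> bool" where
  "one_generator_left_brace A \<longleftrightarrow>
     left_brace A \<and> (\<exists>a\<in>carrier A. subbrace_generated A a = carrier A)"

definition set_star :: "('a, 'm) ring_scheme \<Rightarrow> 'a set \<Rightarrow> 'a set \<Rightarrow> 'a set" where
  "set_star A K L = generate (add_monoid A) {brace_star A x y | x y. x \<in> K \<and> y \<in> L}"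

text \<open>
  \<open>right_power A n\<close> is $A^{(n)}$ and \<open>left_power A k\<close> is $A^k$. Both are indexed
  from 1; the value at 0 is irrelevant.
\<close>

definition right_power :: "('a, 'm) ring_scheme \<Rightarrow> nat \<Rightarrow> 'a set" where
  "right_power A n = ((\<lambda>K. set_star A K (carrier A)) ^^ (n - 1)) (carrier A)"

definition left_power :: "('a, 'm) ring_scheme \<Rightarrow> nat \<Rightarrow> 'a set" where
  "left_power A k = ((\<lambda>L. set_star A (carrier A) L) ^^ (k - 1)) (carrier A)"

definition class_NS :: "nat \<Rightarrow> nat \<Rightarrow> ('a, 'm) ring_scheme set" where
  "class_NS n k = {A. left_brace A
     \<and> 0 < n \<and> right_power A n = {\<zero>\<^bsub>A\<^esub>} \<and> (\<forall>m. 0 < m \<and> m < n \<longrightarrow> right_power A m \<noteq> {\<zero>\<^bsub>A\<^esub>})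
     \<and> 0 < k \<and> left_power A k = {\<zero>\<^bsub>A\<^esub>} \<and> (\<forall>m. 0 < m \<and> m < k \<longrightarrow> left_power A m \<noteq> {\<zero>\<^bsub>A\<^esub>})}"

definition brace_epi :: "('a, 'm) ring_scheme \<Rightarrow> ('b, 'n) ring_scheme \<Rightarrow> ('a \<Rightarrow> 'b) set" where
  "brace_epi A B = {f. f \<in> hom (add_monoid A) (add_monoid B) \<and> f \<in> hom A B
     \<and> f ` carrier A = carrier B}"

definition D_brace :: "(int \<times> int) ring" where
  "D_brace = \<lparr>carrier = UNIV,
     monoid.mult = (\<lambda>(k1, k2) (t1, t2). (k1 + t1, k1 * t1 + k2 + t2)),
     one = (0, 0),
     ring.zero = (0, 0),
     ring.add = (\<lambda>(k1, k2) (t1, t2). (k1 + t1, k2 + t2))\<rparr>"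

end

theory Submission
  imports Defs
begin

text \<open>
  If $A * (A * A) = 0 = (A * A) * A$, then the operation $*$ is biadditive. For a generator $a$
  of $A$ and $b = a * a$ this gives $(ka + lb) * (sa + tb) = ks\,b$, so
  $(k, l) \mapsto ka + lb$ is a homomorphism from $D$; its image is a subbrace containing $a$.
\<close>

context left_brace
begin

lemma star_closed [simp, intro]:
  "x \<in> carrier A \<Longrightarrow> y \<in> carrier A \<Longrightarrow> brace_star A x y \<in> carrier A"
  by (simp add: brace_star_def)

text \<open>The definition of \<open>*\<close> solved for the product: the bridge by which products
  are traded for sums.\<close>

lemma mult_eq_star:
  assumes "x \<in> carrier A" "y \<in> carrier A"
  shows "x \<otimes> y = x \<oplus> y \<oplus> brace_star A x y"
proof -
  have "x \<oplus> y \<oplus> brace_star A x y = (x \<oplus> \<ominus> x) \<oplus> (y \<oplus> \<ominus> y) \<oplus> x \<otimes> y"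
    using assms unfolding brace_star_def minus_eq by (simp add: a_ac del: r_neg)
  then show ?thesis using assms by (simp add: r_neg)
qed

text \<open>This is the brace law rewritten in terms of \<open>*\<close>. Additivity in the left
  argument fails in a general left brace.\<close>

lemma star_add_right:
  assumes "x \<in> carrier A" "y \<in> carrier A" "z \<in> carrier A"
  shows "brace_star A x (y \<oplus> z) = brace_star A x y \<oplus> brace_star A x z"
  using assms unfolding brace_star_def brace_distrib[OF assms] minus_eq
  by (simp add: minus_add a_ac)

text \<open>Associativity in disguise: expand \<open>(x y) z\<close> and \<open>x (y z)\<close> into
  sums by \<open>mult_eq_star\<close> and right additivity, then cancel the common summand
  \<open>x + y + x * y + z\<close>. The term \<open>x * (y * z)\<close> is what vanishes in the
  class-two case below.\<close>

lemma star_mult_left: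
  assumes "x \<in> carrier A" "y \<in> carrier A" "z \<in> carrier A"
  shows "brace_star A (x \<otimes> y) z
    = brace_star A x (brace_star A y z) \<oplus> brace_star A y z \<oplus> brace_star A x z"
proof -
  define u v w where "u = brace_star A y z" and "v = brace_star A x y" and "w = brace_star A x z"
  have c: "u \<in> carrier A" "v \<in> carrier A" "w \<in> carrier A"
    using assms by (simp_all add: u_def v_def w_def)
  have xy: "x \<otimes> y = x \<oplus> y \<oplus> v" and yz: "y \<otimes> z = y \<oplus> z \<oplus> u"
    using assms by (simp_all add: mult_eq_star u_def v_def)
  have "(x \<oplus> y \<oplus> v \<oplus> z) \<oplus> brace_star A (x \<otimes> y) z = (x \<otimes> y) \<otimes> z"
    using assms mult_eq_star[of "x \<otimes> y" z] by (simp add: xy[symmetric])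
  also have "\<dots> = x \<otimes> (y \<oplus> z \<oplus> u)"
    using assms by (simp add: m_assoc yz)
  also have "\<dots> = x \<oplus> (y \<oplus> z \<oplus> u) \<oplus> (v \<oplus> w \<oplus> brace_star A x u)"
    using assms c mult_eq_star[of x "y \<oplus> z \<oplus> u"] by (simp add: star_add_right v_def w_def)
  also have "\<dots> = (x \<oplus> y \<oplus> v \<oplus> z) \<oplus> (brace_star A x u \<oplus> u \<oplus> w)"
    using assms c by (simp add: a_ac)
  finally have "brace_star A (x \<otimes> y) z = brace_star A x u \<oplus> u \<oplus> w"
    using assms c by (simp del: a_assoc)
  then show ?thesis by (simp add: u_def w_def)
qed

lemma star_hom_right:
  "x \<in> carrier A \<Longrightarrow> brace_star A x \<in> hom (add_monoid A) (add_monoid A)"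
  by (auto intro!: homI simp: star_add_right)

end

text \<open>The conditions A * (A * A) = 0 = (A * A) * A, stated on generators so that they serve
  directly as rewrite rules.\<close>

locale class_two_left_brace = left_brace +
  assumes star_star_right:
    "\<lbrakk>x \<in> carrier A; y \<in> carrier A; z \<in> carrier A\<rbrakk> \<Longrightarrow> brace_star A x (brace_star A y z) = \<zero>"
  and star_star_left:
    "\<lbrakk>x \<in> carrier A; y \<in> carrier A; z \<in> carrier A\<rbrakk> \<Longrightarrow> brace_star A (brace_star A x y) z = \<zero>"
begin

text \<open>For \<open>v = x * y\<close> one has \<open>v * u = 0\<close>, so the sum
  \<open>u + v\<close> is the product \<open>v u\<close>. In the expansion of
  \<open>(v u) * z\<close> by \<open>star_mult_left\<close> only \<open>u * z\<close>
  survives.\<close>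

lemma star_add_star_left:
  assumes "x \<in> carrier A" "y \<in> carrier A" "u \<in> carrier A" "z \<in> carrier A"
  shows "brace_star A (u \<oplus> brace_star A x y) z = brace_star A u z"
proof -
  have "brace_star A x y \<otimes> u = u \<oplus> brace_star A x y"
    using assms by (simp add: mult_eq_star[of "brace_star A x y"] star_star_left a_comm)
  moreover have "brace_star A (brace_star A x y \<otimes> u) z = brace_star A u z"
    using assms by (simp add: star_mult_left star_star_left star_star_right)
  ultimately show ?thesis by simp
qed

text \<open>The elements \<open>x + y\<close> and \<open>x y\<close> differ by the summand
  \<open>x * y\<close>, which does not affect \<open>*\<close> on the left. So the sum may be
  replaced by the product, where \<open>star_mult_left\<close> applies and its double term is
  zero.\<close>

lemma star_add_left:
  assumes "x \<in> carrier A" "y \<in> carrier A" "z \<in> carrier A"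
  shows "brace_star A (x \<oplus> y) z = brace_star A x z \<oplus> brace_star A y z"
proof -
  have "brace_star A (x \<oplus> y) z = brace_star A (x \<oplus> y \<oplus> brace_star A x y) z"
    using assms by (simp add: star_add_star_left)
  also have "\<dots> = brace_star A (x \<otimes> y) z"
    using assms by (simp add: mult_eq_star[of x y])
  also have "\<dots> = brace_star A x z \<oplus> brace_star A y z"
    using assms by (simp add: star_mult_left star_star_right a_comm)
  finally show ?thesis .
qed

lemma star_hom_left:
  "z \<in> carrier A \<Longrightarrow> (\<lambda>x. brace_star A x z) \<in> hom (add_monoid A) (add_monoid A)"
  by (auto intro!: homI simp: star_add_left)

lemma star_add_pow_right:
  fixes k :: int
  assumes "x \<in> carrier A" "y \<in> carrier A"
  shows "brace_star A x (add_pow A k y) = add_pow A k (brace_star A x y)"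
  unfolding add_pow_def
  by (rule hom_int_pow[OF star_hom_right]) (use assms a_group in simp_all)

lemma star_add_pow_left:
  fixes k :: int
  assumes "x \<in> carrier A" "y \<in> carrier A"
  shows "brace_star A (add_pow A k x) y = add_pow A k (brace_star A x y)"
  unfolding add_pow_def
  by (rule hom_int_pow[OF star_hom_left]) (use assms a_group in simp_all)

text \<open>By biadditivity the left side splits into four terms, and only the one from
  \<open>a * a\<close> is nonzero. Its coefficient \<open>k * s\<close> matches the correction term
  in the multiplication of \<open>D_brace\<close>.\<close>

lemma star_combination:
  fixes k l s t :: int
  assumes a: "a \<in> carrier A"
  defines "b \<equiv> brace_star A a a"
  shows "brace_star A (add_pow A k a \<oplus> add_pow A l b) (add_pow A s a \<oplus> add_pow A t b)
    = add_pow A (k * s) b"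
proof -
  have b: "b \<in> carrier A" using a by (simp add: b_def)
  \<comment> \<open>Since \<open>b\<close> is itself a value of \<open>*\<close>, it annihilates
    everything from both sides.\<close>
  have "brace_star A x b = \<zero>" "brace_star A b x = \<zero>" if "x \<in> carrier A" for x
    using that a by (simp_all add: b_def star_star_left star_star_right)
  then show ?thesis
    using a b by (simp add: star_add_left star_add_right star_add_pow_left star_add_pow_right
        add.int_pow_pow b_def[symmetric] mult.commute)
qed

end

lemma carrier_D_brace [simp]: "carrier D_brace = UNIV"
  and mult_D_brace [simp]: "(k1, k2) \<otimes>\<^bsub>D_brace\<^esub> (t1, t2) = (k1 + t1, k1 * t1 + k2 + t2)"
  and add_D_brace [simp]: "(k1, k2) \<oplus>\<^bsub>D_brace\<^esub> (t1, t2) = (k1 + t1, k2 + t2)"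
  and zero_D_brace [simp]: "\<zero>\<^bsub>D_brace\<^esub> = (0, 0)"
  and one_D_brace [simp]: "\<one>\<^bsub>D_brace\<^esub> = (0, 0)"
  by (simp_all add: D_brace_def)

lemma abelian_group_D_brace: "abelian_group D_brace"
proof (rule abelian_groupI)
  show "\<exists>y\<in>carrier D_brace. y \<oplus>\<^bsub>D_brace\<^esub> x = \<zero>\<^bsub>D_brace\<^esub>" for x
    by (rule bexI[of _ "(- fst x, - snd x)"]) (cases x; simp)+
qed auto

lemma group_D_brace: "group D_brace"
proof (rule groupI)
  show "\<exists>y\<in>carrier D_brace. y \<otimes>\<^bsub>D_brace\<^esub> x = \<one>\<^bsub>D_brace\<^esub>" for x
    \<comment> \<open>The square compensates for the product \<open>- fst x * fst x\<close> that
      appears in the second coordinate.\<close>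
    by (rule bexI[of _ "(- fst x, fst x * fst x - snd x)"]) (cases x; simp)+
qed (auto simp: algebra_simps)

lemma uminus_D_brace [simp]: "\<ominus>\<^bsub>D_brace\<^esub> (k, l) = (- k, - l)"
proof -
  interpret abelian_group D_brace by (rule abelian_group_D_brace)
  show ?thesis by (rule minus_equality) auto
qed

lemma left_brace_D_brace: "left_brace D_brace"
proof -
  interpret abelian_group D_brace by (rule abelian_group_D_brace)
  interpret group D_brace by (rule group_D_brace)
  show ?thesis
    by unfold_locales (auto simp: minus_eq algebra_simps)
qed

lemma one_generator_D_brace: "one_generator_left_brace D_brace"
proof -
  interpret left_brace D_brace by (rule left_brace_D_brace)
  have "S = UNIV" if S: "subbrace S D_brace" and g: "(1, 0) \<in> S" for S
  proof -
    have sub: "subgroup S (add_monoid D_brace)" "subgroup S D_brace"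
      using S by (simp_all add: subbrace_def)
    have add: "x \<oplus>\<^bsub>D_brace\<^esub> y \<in> S" if "x \<in> S" "y \<in> S" for x y
      using subgroup.m_closed[OF sub(1)] that by simp
    have neg: "\<ominus>\<^bsub>D_brace\<^esub> x \<in> S" if "x \<in> S" for x
      using subgroup.m_inv_closed[OF sub(1)] that by (simp add: a_inv_def)
    have zero: "(0, 0) \<in> S"
      using subgroup.one_closed[OF sub(1)] by simp
    \<comment> \<open>The element written here is \<open>(1, 0) * (1, 0)\<close>, that is (2, 1) -
      (2, 0). It supplies the second additive generator; from there on additive closure
      suffices.\<close>
    have "(1, 0) \<otimes>\<^bsub>D_brace\<^esub> (1, 0) \<oplus>\<^bsub>D_brace\<^esub> \<ominus>\<^bsub>D_brace\<^esub> ((1, 0) \<oplus>\<^bsub>D_brace\<^esub> (1, 0)) \<in> S"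
      using g by (intro add neg subgroup.m_closed[OF sub(2)])
    then have h: "(0, 1) \<in> S" by simp
    have "(k, 0) \<in> S" for k
    proof (induction k rule: int_induct[where k = 0])
      case (step1 i) then show ?case using add[OF _ g, of "(i, 0)"] by simp
    next
      case (step2 i) then show ?case using add[OF _ neg[OF g], of "(i, 0)"] by simp
    qed (rule zero)
    moreover have "(0, l) \<in> S" for l
    proof (induction l rule: int_induct[where k = 0])
      case (step1 i) then show ?case using add[OF _ h, of "(0, i)"] by simp
    next
      case (step2 i) then show ?case using add[OF _ neg[OF h], of "(0, i)"] by simp
    qed (rule zero)
    ultimately have "(k, l) \<in> S" for k l
      using add[of "(k, 0)" "(0, l)"] by simp
    then show ?thesis by auto
  qed
  moreover have "subbrace UNIV D_brace"
    using add.subgroup_self subgroup_self by (simp add: subbrace_def)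
  ultimately have "subbrace_generated D_brace (1, 0) = carrier D_brace"
    unfolding subbrace_generated_def by auto
  then show ?thesis
    unfolding one_generator_left_brace_def using left_brace_D_brace by auto
qed

lemma class_NS_3_3_class_two:
  assumes "A \<in> class_NS 3 3"
  shows "class_two_left_brace A"
proof -
  have "left_brace A" and r: "right_power A 3 = {\<zero>\<^bsub>A\<^esub>}" and l: "left_power A 3 = {\<zero>\<^bsub>A\<^esub>}"
    using assms by (simp_all add: class_NS_def)
  interpret left_brace A by fact
  have star: "brace_star A x y \<in> set_star A K L" if "x \<in> K" "y \<in> L" for x y K L
    unfolding set_star_def using that by (blast intro: generate.incl)
  \<comment> \<open>Indices start at 1, so the power with index 3 is two applications of the star
    with \<open>carrier A\<close>.\<close>
  have "set_star A (set_star A (carrier A) (carrier A)) (carrier A) = {\<zero>\<^bsub>A\<^esub>}"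
    using r by (simp add: right_power_def numeral_2_eq_2)
  moreover have "set_star A (carrier A) (set_star A (carrier A) (carrier A)) = {\<zero>\<^bsub>A\<^esub>}"
    using l by (simp add: left_power_def numeral_2_eq_2)
  \<comment> \<open>Each double star is a generator of one of these two subgroups, hence
    zero.\<close>
  ultimately show ?thesis
    using star star[OF _ star] by unfold_locales (metis singletonD)+
qed

text \<open>Any generator \<open>a\<close> can serve as the image of \<open>(1, 0)\<close>.
  Surjectivity comes from the minimality of the generated subbrace, without an explicit description
  of the elements of \<open>A\<close>.\<close>

lemma (in class_two_left_brace) ex_epi_from_D_brace:
  assumes a: "a \<in> carrier A" and gen: "subbrace_generated A a = carrier A"
  shows "\<exists>f. f \<in> brace_epi D_brace A"
proof -
  interpret D: left_brace D_brace by (rule left_brace_D_brace)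
  define b where "b = brace_star A a a"
  have b: "b \<in> carrier A" using a by (simp add: b_def)
  \<comment> \<open>The formula is forced: a brace homomorphism with \<open>(1, 0)\<close> sent to
    \<open>a\<close> must send \<open>(0, 1) = (1, 0) * (1, 0)\<close> to
    \<open>a * a = b\<close>.\<close>
  define f where "f = (\<lambda>(k :: int, l :: int). add_pow A k a \<oplus> add_pow A l b)"
  have f_closed: "f x \<in> carrier A" for x
    using a b by (cases x) (simp add: f_def)
  have f_add: "f (x \<oplus>\<^bsub>D_brace\<^esub> y) = f x \<oplus> f y" for x y
    using a b by (cases x; cases y) (simp add: f_def add.int_pow_mult a_ac)
  have f_mult: "f (x \<otimes>\<^bsub>D_brace\<^esub> y) = f x \<otimes> f y" for x y
  proof (cases x; cases y)
    fix k l s t :: int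
    assume xy: "x = (k, l)" "y = (s, t)"
    \<comment> \<open>This multiple of \<open>b\<close> is the image under \<open>f\<close> of
      \<open>(0, k * s)\<close>, the amount by which product and sum differ in
      \<open>D_brace\<close>.\<close>
    have "brace_star A (f x) (f y) = add_pow A (k * s) b"
      using star_combination[OF a] by (simp add: xy f_def b_def)
    then have "f x \<otimes> f y = f x \<oplus> f y \<oplus> add_pow A (k * s) b"
      using mult_eq_star f_closed by simp
    then show ?thesis
      using a b by (simp add: xy f_def add.int_pow_mult a_ac)
  qed
  have hom: "f \<in> hom (add_monoid D_brace) (add_monoid A)" "f \<in> hom D_brace A"
    using f_closed f_add f_mult
    by (auto intro!: homI simp del: add_D_brace mult_D_brace split_paired_All)
  \<comment> \<open>The image is a subgroup for both operations and contains \<open>a\<close>, so it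
    is one of the sets intersected in \<open>subbrace_generated A a\<close>.\<close>
  have "subgroup (f ` carrier D_brace) (add_monoid A)"
    using group_hom.img_is_subgroup[of "add_monoid D_brace" "add_monoid A" f] hom(1)
      D.add.is_group add.is_group by (simp add: group_hom_def group_hom_axioms_def)
  moreover have "subgroup (f ` carrier D_brace) A"
    using group_hom.img_is_subgroup[of D_brace A f] hom(2) D.is_group is_group
    by (simp add: group_hom_def group_hom_axioms_def)
  moreover have "a \<in> f ` carrier D_brace"
  proof
    have "add_pow A (0 :: int) b = \<zero>" by (simp add: add_pow_def)
    then show "a = f (1, 0)" using a b by (simp add: f_def)
  qed simp
  ultimately have "subbrace_generated A a \<subseteq> f ` carrier D_brace"
    unfolding subbrace_generated_def subbrace_def by blast
  then have "f ` carrier D_brace = carrier A"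
    using gen f_closed by auto
  with hom show ?thesis unfolding brace_epi_def by blast
qed

theorem theoremB1:
  "one_generator_left_brace D_brace \<and>
   (\<forall>A :: ('a, 'm) ring_scheme.
      one_generator_left_brace A \<and> A \<in> class_NS 3 3 \<longrightarrow> (\<exists>f. f \<in> brace_epi D_brace A))"
proof (intro conjI allI impI)
  fix A :: "('a, 'm) ring_scheme"
  assume A: "one_generator_left_brace A \<and> A \<in> class_NS 3 3"
  then have "\<exists>a\<in>carrier A. subbrace_generated A a = carrier A"
    by (simp add: one_generator_left_brace_def)
  then obtain a where "a \<in> carrier A" "subbrace_generated A a = carrier A"
    by (elim bexE)
  moreover have "class_two_left_brace A"
    using A by (intro class_NS_3_3_class_two) (rule conjunct2)
  ultimately show "\<exists>f. f \<in> brace_epi D_brace A"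
    by (intro class_two_left_brace.ex_epi_from_D_brace)
qed (rule one_generator_D_brace)

end
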